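(* Let $1\leq p_1\leq p_2<\infty$, let $\phi_1\in\mathcal{G}_{p_1}$ and $\phi_2\in\mathcal{G}_{p_2}$. Then the following statements are equivalent: (i) there exists $C>0$ such that $\phi_2(2N+1)\leq C\,\phi_1(2N+1)$ for every $N\in\omega$; (ii) there exists $C>0$ such that $\|x\|_{w\ell^{p_1}_{\phi_1}}\leq C\,\|x\|_{w\ell^{p_2}_{\phi_2}}$ for every $x\in w\ell^{p_2}_{\phi_2}$; (iii) $w\ell^{p_2}_{\phi_2}\subseteq w\ell^{p_1}_{\phi_1}$.
   Context: Let $\mathbb{K}$ be $\mathbb{R}$ or $\mathbb{C}$, and $\omega=\mathbb{N}\cup\{0\}=\{0,1,2,\dots\}$. For $m\in\mathbb{Z}$ and $N\in\omega$ put $S_{m,N}=\{m-N,\dots,m,\dots,m+N\}$, and let $|S|$ denote the cardinality of a finite set $S$, so $|S_{m,N}|=2N+1$. Let $2\omega+1=\{2N+1: N\in\omega\}$. For $1\leq p<\infty$, $\mathcal{G}_p$ is the set of all functions $\phi:2\omega+1\to(0,\infty)$ such that (a) $\phi$ is almost decreasing: there exists $C>0$ with $\phi(2M+1)\geq C\,\phi(2N+1)$ for all $M,N\in\omega$ with $M\leq N$; and (b) $(2N+1)\mapsto(2N+1)^{1/p}\phi(2N+1)$ is almost increasing: there exists $C>0$ with $(2M+1)^{1/p}\phi(2M+1)\leq C\,(2N+1)^{1/p}\phi(2N+1)$ for all $M,N\in\omega$ with $M\leq N$. For $1\leq p<\infty$ and $\phi\in\mathcal{G}_p$, the generalized weak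 type discrete Morrey space $w\ell^p_\phi$ is the set of all sequences $x=(x_k)_{k\in\mathbb{Z}}$ in $\mathbb{K}$ such that $$\|x\|_{w\ell^p_\phi}:=\sup_{m\in\mathbb{Z},\,N\in\omega,\,\gamma>0}\frac{\gamma}{\phi(2N+1)}\left(\frac{|\{k\in S_{m,N}: |x_k|>\gamma\}|}{|S_{m,N}|}\right)^{1/p}<\infty.$$ The expression $\|x\|_{w\ell^p_\phi}\in[0,\infty]$ is defined by the same supremum for every sequence $x$. *)

theory Defs
  imports "HOL-Analysis.Analysis"
begin

text \<open>
  The scalar field is a type of class \<^class>\<open>real_normed_field\<close>: \<open>real\<close> and \<open>complex\<close> are
  instances, and by the Gelfand-Mazur/Ostrowski theorem they are the only ones up to isometric
  isomorphism.
\<close>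

definition window :: "int \<Rightarrow> nat \<Rightarrow> int set" where
  "window m N = {m - int N..m + int N}"

definition odd_nats :: "nat set" where
  "odd_nats = {2 * N + 1 |N. True}"

text \<open>
  A function on the odd naturals is a function on \<open>nat\<close> that is only ever evaluated at odd
  arguments; its values elsewhere are irrelevant.
\<close>

definition almost_decreasing :: "(nat \<Rightarrow> real) \<Rightarrow> bool" where
  "almost_decreasing \<phi> \<longleftrightarrow>
     (\<exists>C>0. \<forall>M N. M \<le> N \<longrightarrow> \<phi> (2 * M + 1) \<ge> C * \<phi> (2 * N + 1))"

definition almost_increasing :: "(nat \<Rightarrow> real) \<Rightarrow> bool" where
  "almost_increasing \<phi> \<longleftrightarrow>
     (\<exists>C>0. \<forall>M N. M \<le> N \<longrightarrow> \<phi> (2 * M + 1) \<le> C * \<phi> (2 * N + 1))"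

definition morrey_class :: "real \<Rightarrow> (nat \<Rightarrow> real) set" where
  "morrey_class p = {\<phi> \<in> odd_nats \<rightarrow> {0<..}.
            almost_decreasing \<phi> \<and> almost_increasing (\<lambda>n. real n powr (1 / p) * \<phi> n)}"

text \<open>The supremum is taken in \<open>[0, \<infinity>]\<close>; for \<open>\<phi> \<in> morrey_class p\<close> every term is a nonnegative real.\<close>

definition weak_morrey_norm ::
  "real \<Rightarrow> (nat \<Rightarrow> real) \<Rightarrow> (int \<Rightarrow> 'a::real_normed_field) \<Rightarrow> ennreal" where
  "weak_morrey_norm p \<phi> x =
     (SUP (m, N, \<gamma>) \<in> UNIV \<times> UNIV \<times> {0<..}.
        ennreal (\<gamma> / \<phi> (2 * N + 1) *
          (real (card {k \<in> window m N. norm (x k) > \<gamma>}) / real (card (window m N))) powr (1 / p)))"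

definition weak_morrey_space ::
  "real \<Rightarrow> (nat \<Rightarrow> real) \<Rightarrow> (int \<Rightarrow> 'a::real_normed_field) set" where
  "weak_morrey_space p \<phi> = {x. weak_morrey_norm p \<phi> x < \<infinity>}"

end

theory Submission
  imports Defs
begin

text \<open>
  A pointwise bound \<open>\<phi>\<^sub>2 \<le> C * \<phi>\<^sub>1\<close> compares the two suprema term by term: the fractions of
  indices lie in \<open>[0, 1]\<close>, where lowering the exponent from \<open>1 / p\<^sub>1\<close> to \<open>1 / p\<^sub>2\<close> only
  increases a power (lemma \<open>weak_morrey_norm_le\<close>). A norm inequality trivially yields the inclusion.

  The inclusion yields the pointwise bound by means of one single test sequence, the radial
  profile \<open>x k = \<phi>\<^sub>2 (2 * \<bar>k\<bar> + 1)\<close>. It always belongs to the space of \<open>\<phi>\<^sub>2\<close>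
  (lemma \<open>radial_profile_in_space\<close>): inside a window of radius \<open>N\<close> a superlevel set of the
  profile is either contained in a centred window of radius \<open>L \<le> N\<close>, and then the growth of
  \<open>n powr (1 / p) * \<phi>\<^sub>2 n\<close> bounds it, or it reaches beyond radius \<open>N\<close>, and then the decay of
  \<open>\<phi>\<^sub>2\<close> bounds the level. On the other hand, by the decay of \<open>\<phi>\<^sub>2\<close> the profile is at least a
  fixed multiple of \<open>\<phi>\<^sub>2 (2 * N + 1)\<close> on the whole centred window of radius \<open>N\<close>, so that its
  norm in the space of \<open>\<phi>\<^sub>1\<close> dominates every ratio \<open>\<phi>\<^sub>2 (2 * N + 1) / \<phi>\<^sub>1 (2 * N + 1)\<close>
  (lemma \<open>dominated_if_radial_profile_in_space\<close>). Testing the inclusion on this sequence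
  replaces an appeal to the closed graph theorem.
\<close>

lemma card_window [simp]: "card (window m N) = 2 * N + 1"
  by (simp add: window_def)

lemma finite_window [simp]: "finite (window m N)"
  by (simp add: window_def)

lemma morrey_class_pos:
  assumes "\<phi> \<in> morrey_class p"
  shows "\<phi> (2 * N + 1) > 0"
  using assms by (auto simp: morrey_class_def odd_nats_def Pi_iff)

lemma weak_morrey_norm_upper:
  assumes "\<gamma> > 0"
  shows "ennreal (\<gamma> / \<phi> (2 * N + 1) *
           (real (card {k \<in> window m N. norm (x k) > \<gamma>}) / real (2 * N + 1)) powr (1 / p))
         \<le> weak_morrey_norm p \<phi> x"
  unfolding weak_morrey_norm_def
  by (rule SUP_upper2[of "(m, N, \<gamma>)"]) (use assms in auto)

lemma weak_morrey_norm_least: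
  assumes "\<And>m N \<gamma>. \<gamma> > 0 \<Longrightarrow> ennreal (\<gamma> / \<phi> (2 * N + 1) *
             (real (card {k \<in> window m N. norm (x k) > \<gamma>}) / real (2 * N + 1)) powr (1 / p)) \<le> B"
  shows "weak_morrey_norm p \<phi> x \<le> B"
  unfolding weak_morrey_norm_def
  by (rule SUP_least) (use assms in auto)

lemma superlevel_fraction_le_1:
  "real (card {k \<in> window m N. P k}) / real (2 * N + 1) \<le> 1"
proof -
  have "card {k \<in> window m N. P k} \<le> card (window m N)"
    by (intro card_mono) auto
  then show ?thesis
    by (simp del: of_nat_Suc of_nat_add)
qed

lemma weak_morrey_norm_le:
  fixes x :: "int \<Rightarrow> 'a::real_normed_field"
  assumes p: "0 < p\<^sub>1" "p\<^sub>1 \<le> p\<^sub>2" and "C > 0"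
    and pos: "\<And>N. \<phi>\<^sub>1 (2 * N + 1) > 0" "\<And>N. \<phi>\<^sub>2 (2 * N + 1) > 0"
    and le: "\<And>N. \<phi>\<^sub>2 (2 * N + 1) \<le> C * \<phi>\<^sub>1 (2 * N + 1)"
  shows "weak_morrey_norm p\<^sub>1 \<phi>\<^sub>1 x \<le> ennreal C * weak_morrey_norm p\<^sub>2 \<phi>\<^sub>2 x"
proof (rule weak_morrey_norm_least)
  fix m :: int and N :: nat and \<gamma> :: real
  assume \<gamma>: "\<gamma> > 0"
  define r where "r = real (card {k \<in> window m N. norm (x k) > \<gamma>}) / real (2 * N + 1)"
  have r: "0 \<le> r" "r \<le> 1"
    unfolding r_def using superlevel_fraction_le_1 by auto
  have "r powr (1 / p\<^sub>1) \<le> r powr (1 / p\<^sub>2)"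
    using r p by (intro powr_mono') (auto simp: field_simps)
  moreover have "\<gamma> / \<phi>\<^sub>1 (2 * N + 1) \<le> C * (\<gamma> / \<phi>\<^sub>2 (2 * N + 1))"
    using pos[of N] le[of N] \<gamma> \<open>C > 0\<close>
    by (simp add: divide_simps mult.commute mult_left_mono)
  ultimately have "\<gamma> / \<phi>\<^sub>1 (2 * N + 1) * r powr (1 / p\<^sub>1)
      \<le> C * (\<gamma> / \<phi>\<^sub>2 (2 * N + 1)) * r powr (1 / p\<^sub>2)"
    using pos(2)[of N] \<gamma> \<open>C > 0\<close> by (intro mult_mono) auto
  then have "ennreal (\<gamma> / \<phi>\<^sub>1 (2 * N + 1) * r powr (1 / p\<^sub>1))
      \<le> ennreal C * ennreal (\<gamma> / \<phi>\<^sub>2 (2 * N + 1) * r powr (1 / p\<^sub>2))"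
    using \<open>C > 0\<close> pos(2)[of N] \<gamma> by (subst ennreal_mult[symmetric]) (auto simp: mult.assoc intro: ennreal_leI)
  also have "\<dots> \<le> ennreal C * weak_morrey_norm p\<^sub>2 \<phi>\<^sub>2 x"
    unfolding r_def using weak_morrey_norm_upper[OF \<gamma>] by (rule mult_left_mono) simp
  finally show "ennreal (\<gamma> / \<phi>\<^sub>1 (2 * N + 1) *
      (real (card {k \<in> window m N. norm (x k) > \<gamma>}) / real (2 * N + 1)) powr (1 / p\<^sub>1))
      \<le> ennreal C * weak_morrey_norm p\<^sub>2 \<phi>\<^sub>2 x"
    unfolding r_def .
qed

definition radial_profile :: "(nat \<Rightarrow> real) \<Rightarrow> int \<Rightarrow> 'a::real_normed_field" where
  "radial_profile \<phi> k = of_real (\<phi> (2 * nat \<bar>k\<bar> + 1))"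

lemma norm_radial_profile:
  assumes "\<And>N. \<phi> (2 * N + 1) > 0"
  shows "norm (radial_profile \<phi> k :: 'a::real_normed_field) = \<phi> (2 * nat \<bar>k\<bar> + 1)"
  using assms[of "nat \<bar>k\<bar>"] by (simp add: radial_profile_def)

text \<open>
  The two defining properties of the class match the two ways in which a superlevel set can lie
  relative to the radius \<open>N\<close>. The resulting bound on the norm is the larger of the two constants.
\<close>

lemma radial_profile_in_space:
  assumes \<phi>: "\<phi> \<in> morrey_class p" and p: "p > 0"
  shows "(radial_profile \<phi> :: int \<Rightarrow> 'a::real_normed_field) \<in> weak_morrey_space p \<phi>"
proof -
  have pos: "\<And>N. \<phi> (2 * N + 1) > 0"
    using \<phi> by (rule morrey_class_pos)
  obtain c where c: "c > 0" "\<And>M N. M \<le> N \<Longrightarrow> c * \<phi> (2 * N + 1) \<le> \<phi> (2 * M + 1)"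
    using \<phi> unfolding morrey_class_def almost_decreasing_def by auto
  obtain D where D: "D > 0"
    "\<And>M N. M \<le> N \<Longrightarrow> real (2 * M + 1) powr (1 / p) * \<phi> (2 * M + 1)
                         \<le> D * (real (2 * N + 1) powr (1 / p) * \<phi> (2 * N + 1))"
    using \<phi> unfolding morrey_class_def almost_increasing_def by auto
  have "weak_morrey_norm p \<phi> (radial_profile \<phi> :: int \<Rightarrow> 'a) \<le> ennreal (max (1 / c) D)"
  proof (rule weak_morrey_norm_least, rule ennreal_leI)
    fix m :: int and N :: nat and \<gamma> :: real
    assume \<gamma>: "\<gamma> > 0"
    define A where "A = {k \<in> window m N. norm (radial_profile \<phi> k :: 'a) > \<gamma>}"
    define r where "r = real (card A) / real (2 * N + 1)"
    have r: "0 \<le> r" "r \<le> 1"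
      unfolding r_def A_def using superlevel_fraction_le_1 by auto
    have level: "\<gamma> < \<phi> (2 * nat \<bar>k\<bar> + 1)" if "k \<in> A" for k
      using that by (simp add: A_def norm_radial_profile[of \<phi>, OF pos])
    have "finite A"
      by (simp add: A_def)
    have "\<gamma> * r powr (1 / p) \<le> max (1 / c) D * \<phi> (2 * N + 1)"
    proof (cases "A = {}")
      case True
      then show ?thesis
        using c(1) pos[of N] by (simp add: r_def le_max_iff_disj)
    next
      case False
      \<comment> \<open>\<open>L\<close> is the radius of the smallest centred window containing the superlevel set \<open>A\<close>.\<close>
      define L where "L = Max ((\<lambda>k. nat \<bar>k\<bar>) ` A)"
      have "L \<in> (\<lambda>k. nat \<bar>k\<bar>) ` A"
        unfolding L_def using \<open>finite A\<close> False by (intro Max_in) auto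
      then have L: "\<gamma> < \<phi> (2 * L + 1)"
        using level by auto
      have Lmax: "nat \<bar>k\<bar> \<le> L" if "k \<in> A" for k
        unfolding L_def using \<open>finite A\<close> that by (intro Max_ge) auto
      show ?thesis
      proof (cases "L \<le> N")
        case True
        have "A \<subseteq> window 0 L"
        proof
          fix k assume "k \<in> A"
          then show "k \<in> window 0 L"
            using Lmax[of k] by (simp add: window_def) linarith
        qed
        then have "card A \<le> 2 * L + 1"
          using card_mono[OF finite_window, of A 0 L] by simp
        then have "r powr (1 / p) \<le> (real (2 * L + 1) / real (2 * N + 1)) powr (1 / p)"
          unfolding r_def using p
          by (intro powr_mono2 divide_right_mono) (auto simp del: of_nat_Suc of_nat_add)
        then have "\<gamma> * r powr (1 / p)
            \<le> \<phi> (2 * L + 1) * (real (2 * L + 1) / real (2 * N + 1)) powr (1 / p)"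
          using L \<gamma> by (intro mult_mono) auto
        also have "\<dots> = real (2 * L + 1) powr (1 / p) * \<phi> (2 * L + 1) / real (2 * N + 1) powr (1 / p)"
          by (subst powr_divide) (auto simp: mult_ac)
        also have "\<dots> \<le> D * \<phi> (2 * N + 1)"
          using D(2)[OF True] by (simp add: divide_le_eq mult_ac)
        also have "\<dots> \<le> max (1 / c) D * \<phi> (2 * N + 1)"
          using pos[of N] by (intro mult_right_mono) auto
        finally show ?thesis .
      next
        case False
        have "\<gamma> * r powr (1 / p) \<le> \<gamma> * 1"
          using \<gamma> r p by (intro mult_left_mono powr_le1) auto
        also have "\<dots> \<le> 1 / c * \<phi> (2 * N + 1)"
        proof -
          have "c * \<gamma> \<le> c * \<phi> (2 * L + 1)"
            using L c(1) by (intro mult_left_mono) auto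
          also have "\<dots> \<le> \<phi> (2 * N + 1)"
            using False by (intro c(2)) auto
          finally show ?thesis
            using c(1) by (simp add: pos_le_divide_eq mult.commute)
        qed
        also have "\<dots> \<le> max (1 / c) D * \<phi> (2 * N + 1)"
          using pos[of N] by (intro mult_right_mono) auto
        finally show ?thesis .
      qed
    qed
    then show "\<gamma> / \<phi> (2 * N + 1) *
        (real (card {k \<in> window m N. norm (radial_profile \<phi> k :: 'a) > \<gamma>}) / real (2 * N + 1)) powr (1 / p)
        \<le> max (1 / c) D"
      using pos[of N] by (simp add: r_def A_def divide_le_eq)
  qed
  then show ?thesis
    by (simp add: weak_morrey_space_def le_less_trans[OF _ ennreal_less_top])
qed

text \<open>
  On the centred window of radius \<open>N\<close> the profile is at least \<open>c * \<phi>\<^sub>2 (2 * N + 1)\<close>, where \<open>c\<close> is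
  a constant of almost decrease. At a level strictly below that value the superlevel set is the
  whole window, so the corresponding term of the supremum is the level divided by
  \<open>\<phi>\<^sub>1 (2 * N + 1)\<close>.
\<close>

lemma dominated_if_radial_profile_in_space:
  assumes mem: "(radial_profile \<phi>\<^sub>2 :: int \<Rightarrow> 'a::real_normed_field) \<in> weak_morrey_space p \<phi>\<^sub>1"
    and "almost_decreasing \<phi>\<^sub>2"
    and pos: "\<And>N. \<phi>\<^sub>1 (2 * N + 1) > 0" "\<And>N. \<phi>\<^sub>2 (2 * N + 1) > 0"
  shows "\<exists>C>0. \<forall>N. \<phi>\<^sub>2 (2 * N + 1) \<le> C * \<phi>\<^sub>1 (2 * N + 1)"
proof -
  obtain c where c: "c > 0" "\<And>M N. M \<le> N \<Longrightarrow> c * \<phi>\<^sub>2 (2 * N + 1) \<le> \<phi>\<^sub>2 (2 * M + 1)"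
    using \<open>almost_decreasing \<phi>\<^sub>2\<close> unfolding almost_decreasing_def by auto
  obtain B where B: "B \<ge> 0"
    "weak_morrey_norm p \<phi>\<^sub>1 (radial_profile \<phi>\<^sub>2 :: int \<Rightarrow> 'a) = ennreal B"
    using mem by (cases "weak_morrey_norm p \<phi>\<^sub>1 (radial_profile \<phi>\<^sub>2 :: int \<Rightarrow> 'a)")
      (auto simp: weak_morrey_space_def)
  have bound: "c / 2 * \<phi>\<^sub>2 (2 * N + 1) \<le> B * \<phi>\<^sub>1 (2 * N + 1)" for N
  proof -
    define \<gamma> where "\<gamma> = c / 2 * \<phi>\<^sub>2 (2 * N + 1)"
    have \<gamma>: "\<gamma> > 0" "\<gamma> < c * \<phi>\<^sub>2 (2 * N + 1)"
      using c(1) pos(2)[of N] by (simp_all add: \<gamma>_def)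
    have "norm (radial_profile \<phi>\<^sub>2 k :: 'a) > \<gamma>" if "k \<in> window 0 N" for k
    proof -
      have "nat \<bar>k\<bar> \<le> N"
        using that by (auto simp: window_def)
      then show ?thesis
        using c(2) \<gamma>(2) unfolding norm_radial_profile[of \<phi>\<^sub>2, OF pos(2)] by (meson less_le_trans)
    qed
    then have "{k \<in> window 0 N. norm (radial_profile \<phi>\<^sub>2 k :: 'a) > \<gamma>} = window 0 N"
      by auto
    then have "ennreal (\<gamma> / \<phi>\<^sub>1 (2 * N + 1)) \<le> ennreal B"
      using weak_morrey_norm_upper[OF \<gamma>(1), of \<phi>\<^sub>1 N 0 "radial_profile \<phi>\<^sub>2 :: int \<Rightarrow> 'a" p]
      by (simp add: B(2) del: of_nat_Suc of_nat_add)
    then show ?thesis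
      using B(1) pos(1)[of N] by (simp add: \<gamma>_def divide_le_eq)
  qed
  \<comment> \<open>The summand 1 makes the constant positive.\<close>
  show ?thesis
  proof (intro exI conjI allI)
    show "2 * B / c + 1 > 0"
      using B(1) c(1) by (simp add: add_nonneg_pos)
    show "\<phi>\<^sub>2 (2 * N + 1) \<le> (2 * B / c + 1) * \<phi>\<^sub>1 (2 * N + 1)" for N
    proof -
      have "\<phi>\<^sub>2 (2 * N + 1) \<le> 2 * B / c * \<phi>\<^sub>1 (2 * N + 1)"
        using bound[of N] c(1) by (simp add: field_simps)
      then show ?thesis
        using pos(1)[of N] by (simp add: distrib_right)
    qed
  qed
qed

theorem theorem5p4:
  fixes p\<^sub>1 p\<^sub>2 :: real and \<phi>\<^sub>1 \<phi>\<^sub>2 :: "nat \<Rightarrow> real"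
  assumes "1 \<le> p\<^sub>1" and "p\<^sub>1 \<le> p\<^sub>2" and "\<phi>\<^sub>1 \<in> morrey_class p\<^sub>1" and "\<phi>\<^sub>2 \<in> morrey_class p\<^sub>2"
  shows "((\<exists>C>0. \<forall>N. \<phi>\<^sub>2 (2 * N + 1) \<le> C * \<phi>\<^sub>1 (2 * N + 1)) \<longleftrightarrow>
          (\<exists>C::real. C > 0 \<and> (\<forall>x \<in> (weak_morrey_space p\<^sub>2 \<phi>\<^sub>2 :: (int \<Rightarrow> 'a::real_normed_field) set).
             weak_morrey_norm p\<^sub>1 \<phi>\<^sub>1 x \<le> ennreal C * weak_morrey_norm p\<^sub>2 \<phi>\<^sub>2 x))) \<and>
         ((\<exists>C::real. C > 0 \<and> (\<forall>x \<in> (weak_morrey_space p\<^sub>2 \<phi>\<^sub>2 :: (int \<Rightarrow> 'a) set).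
             weak_morrey_norm p\<^sub>1 \<phi>\<^sub>1 x \<le> ennreal C * weak_morrey_norm p\<^sub>2 \<phi>\<^sub>2 x)) \<longleftrightarrow>
          (weak_morrey_space p\<^sub>2 \<phi>\<^sub>2 :: (int \<Rightarrow> 'a) set) \<subseteq> weak_morrey_space p\<^sub>1 \<phi>\<^sub>1)"
    (is "(?dominated \<longleftrightarrow> ?bounded) \<and> (?bounded \<longleftrightarrow> ?included)")
proof -
  have pos: "\<And>N. \<phi>\<^sub>1 (2 * N + 1) > 0" "\<And>N. \<phi>\<^sub>2 (2 * N + 1) > 0"
    using assms(3,4) by (blast intro: morrey_class_pos)+
  have "?bounded" if "?dominated"
  proof -
    from that obtain C where "C > 0" "\<And>N. \<phi>\<^sub>2 (2 * N + 1) \<le> C * \<phi>\<^sub>1 (2 * N + 1)"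
      by blast
    then show ?thesis
      using assms(1,2) pos by (intro exI[of _ C] conjI ballI weak_morrey_norm_le) auto
  qed
  moreover have "?included" if bounded: "?bounded"
  proof
    fix x :: "int \<Rightarrow> 'a"
    assume x: "x \<in> weak_morrey_space p\<^sub>2 \<phi>\<^sub>2"
    obtain C where "weak_morrey_norm p\<^sub>1 \<phi>\<^sub>1 x \<le> ennreal C * weak_morrey_norm p\<^sub>2 \<phi>\<^sub>2 x"
      using bounded x by blast
    also have "\<dots> < \<infinity>"
      using x by (simp add: weak_morrey_space_def ennreal_mult_less_top)
    finally show "x \<in> weak_morrey_space p\<^sub>1 \<phi>\<^sub>1"
      by (simp add: weak_morrey_space_def)
  qed
  moreover have "?dominated" if "?included"
  proof (rule dominated_if_radial_profile_in_space)
    show "(radial_profile \<phi>\<^sub>2 :: int \<Rightarrow> 'a) \<in> weak_morrey_space p\<^sub>1 \<phi>\<^sub>1"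
      using that radial_profile_in_space[OF assms(4)] assms(1,2) by auto
    show "almost_decreasing \<phi>\<^sub>2"
      using assms(4) by (simp add: morrey_class_def)
  qed (fact pos)+
  ultimately show ?thesis
    by blast
qed

end
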